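(* Let $Q\in\mathbb{R}^{n\times n}$ be a symmetric matrix with smallest eigenvalue $\lambda_1(Q)$, let $q\in\mathbb{R}^n$, and let $C\subset\mathbb{R}^n$ be a nonempty closed convex set. For any $x^0\in\mathbb{R}^n$, any $\rho>0$ with $\rho>-\lambda_1(Q)$, and any $\eta>0$, there exists a unique $C^1$ function $x:\mathbb{R}\to\mathbb{R}^n$ such that $x(0)=x^0$ and $$\dot{x}(t)=\frac{1}{\eta}\left[F_C(x(t))-x(t)\right]\quad\text{for all } t\in\mathbb{R}.$$
   Context: For $u\in\mathbb{R}^n$, $F_C(u)$ denotes the unique solution of the strongly convex problem $$\min\Big\{\tfrac{1}{2}x^TQx+q^Tx+\tfrac{\rho}{2}\|x-u\|^2 \;\Big|\; x\in C\Big\},$$ where $\|\cdot\|$ is the Euclidean norm (strong convexity holds because $\rho>-\lambda_1(Q)$). *)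

theory Defs
  imports "HOL-Analysis.Analysis"
begin

definition eigenvalues :: "real^'n^'n \<Rightarrow> real set" where
  "eigenvalues A = {l. \<exists>v. v \<noteq> 0 \<and> A *v v = l *\<^sub>R v}"

text \<open>Meaningful for symmetric matrices, whose (real) eigenvalues form a finite nonempty set.\<close>

definition smallest_eigenvalue :: "real^'n^'n \<Rightarrow> real" where
  "smallest_eigenvalue A = Min (eigenvalues A)"

definition prox_objective ::
    "real^'n^'n \<Rightarrow> real^'n \<Rightarrow> real \<Rightarrow> real^'n \<Rightarrow> real^'n \<Rightarrow> real" where
  "prox_objective Q q \<rho> u x =
     1/2 * (x \<bullet> (Q *v x)) + q \<bullet> x + \<rho>/2 * (norm (x - u))\<^sup>2"

text \<open>The description operator is used for the unique minimizer over \<^term>\<open>C\<close>; it exists when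
  \<^term>\<open>C\<close> is nonempty, closed and convex, \<^term>\<open>Q\<close> is symmetric and
  \<^prop>\<open>\<rho> > - smallest_eigenvalue Q\<close>, the objective then being strongly convex.\<close>

definition F_C ::
    "real^'n^'n \<Rightarrow> real^'n \<Rightarrow> real \<Rightarrow> (real^'n) set \<Rightarrow> real^'n \<Rightarrow> real^'n" where
  "F_C Q q \<rho> C u = (THE x. is_arg_min (prox_objective Q q \<rho> u) (\<lambda>x. x \<in> C) x)"

end

theory Submission
  imports Defs
begin

text \<open>By the spectral characterisation of the smallest eigenvalue as the minimum of the Rayleigh quotient, the
  objective is strongly convex with modulus \<open>c = \<lambda>\<^sub>1(Q) + \<rho>\<close>. Adding the variational inequalities at the minimizers
  for two parameters shows that the proximal map is Lipschitz with constant \<open>\<rho> / c\<close>. The vector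
  field is therefore globally Lipschitz, and the Picard operator is a contraction of an exponentially weighted
  space of functions on the whole line.\<close>

section \<open>The smallest eigenvalue of a symmetric matrix\<close>

lemma symmetric_inner:
  fixes A :: "real^'n^'n"
  assumes "transpose A = A"
  shows "x \<bullet> (A *v y) = y \<bullet> (A *v x)"
  by (metis assms dot_lmul_matrix inner_commute vector_transpose_matrix)

text \<open>Eigenvectors of distinct eigenvalues are orthogonal, and a pairwise orthogonal set in
  finite dimension is finite. This is what makes the \<open>Min\<close> in
  \<open>smallest_eigenvalue\<close> a genuine minimum.\<close>

lemma finite_eigenvalues_symmetric:
  fixes A :: "real^'n^'n"
  assumes sym: "transpose A = A"
  shows "finite (eigenvalues A)"
proof -
  define v where "v l = (SOME v. v \<noteq> 0 \<and> A *v v = l *\<^sub>R v)" for l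
  have v: "v l \<noteq> 0 \<and> A *v v l = l *\<^sub>R v l" if "l \<in> eigenvalues A" for l
    unfolding v_def by (rule someI_ex) (use that in \<open>simp add: eigenvalues_def\<close>)
  have orth: "orthogonal (v l) (v m)" if "l \<in> eigenvalues A" "m \<in> eigenvalues A" "l \<noteq> m" for l m
  proof -
    have "v l \<bullet> (A *v v m) = v m \<bullet> (A *v v l)"
      by (rule symmetric_inner[OF sym])
    then have "m * (v l \<bullet> v m) = l * (v l \<bullet> v m)"
      using v that by (simp add: inner_commute)
    then show ?thesis using \<open>l \<noteq> m\<close> by (simp add: orthogonal_def)
  qed
  have "inj_on v (eigenvalues A)"
    using orth v by (metis inj_onI orthogonal_self)
  moreover have "finite (v ` eigenvalues A)"
    by (rule pairwise_orthogonal_imp_finite) (auto simp: pairwise_def intro: orth)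
  ultimately show ?thesis by (rule finite_imageD[rotated])
qed

text \<open>The quadratic form attains its minimum \<open>m\<close> on the compact unit sphere,
  homogeneity carries the bound to all vectors, and first-order optimality makes the minimizer an
  eigenvector.\<close>

lemma Rayleigh_minimum_eigenvalue:
  fixes A :: "real^'n^'n"
  assumes sym: "transpose A = A"
  obtains m where "m \<in> eigenvalues A" and "\<And>x. m * (x \<bullet> x) \<le> x \<bullet> (A *v x)"
proof -
  have "sphere (0::real^'n) 1 \<noteq> {}" by simp
  moreover have "continuous_on (sphere 0 1) (\<lambda>x. x \<bullet> (A *v x))"
    by (intro continuous_intros linear_continuous_on matrix_vector_mul_bounded_linear)
  ultimately obtain v where v: "norm v = 1" 
    and vmin: "\<And>x. norm x = 1 \<Longrightarrow> v \<bullet> (A *v v) \<le> x \<bullet> (A *v x)"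
    using continuous_attains_inf[of "sphere 0 1" "\<lambda>x. x \<bullet> (A *v x)"] by auto
  define m where "m = v \<bullet> (A *v v)"
  have bound: "m * (x \<bullet> x) \<le> x \<bullet> (A *v x)" for x
  proof (cases "x = 0")
    case False
    define y where "y = (1 / norm x) *\<^sub>R x"
    have y: "norm y = 1" "x = norm x *\<^sub>R y" using False by (auto simp: y_def)
    have "x \<bullet> (A *v x) = (norm x)\<^sup>2 * (y \<bullet> (A *v y))"
      by (subst (1 2) y(2)) (simp add: matrix_vector_mult_scaleR power2_eq_square)
    moreover have "m \<le> y \<bullet> (A *v y)" using vmin[OF y(1)] by (simp add: m_def)
    ultimately show ?thesis
      by (simp add: dot_square_norm mult.commute[of _ "(norm x)\<^sup>2"] mult_left_mono)
  qed simp
  \<comment> \<open>The nonnegative form of \<open>A - m\<close> vanishes at \<open>v\<close>; perturbing \<open>v\<close> in the direction \<open>w\<close> shows \<open>w = 0\<close>.\<close>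
  define w where "w = A *v v - m *\<^sub>R v"
  define c where "c = w \<bullet> (A *v w) - m * (w \<bullet> w)"
  have vv: "v \<bullet> v = 1" using v by (simp add: dot_square_norm)
  have c0: "c \<ge> 0" using bound[of w] by (simp add: c_def)
  have quad: "0 \<le> 2 * t * (w \<bullet> w) + t\<^sup>2 * c" for t
  proof -
    have "(v + t *\<^sub>R w) \<bullet> (A *v (v + t *\<^sub>R w)) - m * ((v + t *\<^sub>R w) \<bullet> (v + t *\<^sub>R w))
       = (m - m * (v \<bullet> v)) + 2 * t * (w \<bullet> (A *v v) - m * (w \<bullet> v)) + t\<^sup>2 * c"
      by (simp add: matrix_vector_right_distrib matrix_vector_mult_scaleR inner_add_left inner_add_right
          symmetric_inner[OF sym, of v w] inner_commute[of v w] c_def m_def power2_eq_square algebra_simps)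
    moreover have "w \<bullet> (A *v v) - m * (w \<bullet> v) = w \<bullet> w"
      by (simp add: w_def inner_diff_right)
    ultimately show ?thesis using bound[of "v + t *\<^sub>R w"] vv by simp
  qed
  have "w = 0"
  proof (rule ccontr)
    assume "w \<noteq> 0"
    then have p: "w \<bullet> w > 0" by simp
    \<comment> \<open>So small that at \<open>t = - s\<close> the quadratic term cancels at most
      half of the negative linear term; the \<open>+ 1\<close> covers \<open>c = 0\<close>.\<close>
    define s where "s = (w \<bullet> w) / (c + 1)"
    have s: "s > 0" "s * c \<le> w \<bullet> w" using p c0 by (auto simp: s_def field_simps)
    have "0 \<le> s * (s * c - 2 * (w \<bullet> w))" using quad[of "- s"] by (simp add: power2_eq_square algebra_simps)
    then show False using s p by (simp add: zero_le_mult_iff)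
  qed
  then have "m \<in> eigenvalues A"
    using v unfolding eigenvalues_def w_def by (auto intro!: exI[of _ v])
  then show ?thesis using bound that by blast
qed

lemma smallest_eigenvalue_le_Rayleigh:
  fixes A :: "real^'n^'n"
  assumes "transpose A = A"
  shows "smallest_eigenvalue A * (x \<bullet> x) \<le> x \<bullet> (A *v x)"
proof -
  obtain m where m: "m \<in> eigenvalues A" "m * (x \<bullet> x) \<le> x \<bullet> (A *v x)"
    using Rayleigh_minimum_eigenvalue[OF assms] by metis
  have "smallest_eigenvalue A \<le> m"
    unfolding smallest_eigenvalue_def using finite_eigenvalues_symmetric[OF assms] m by auto
  then have "smallest_eigenvalue A * (x \<bullet> x) \<le> m * (x \<bullet> x)"
    by (rule mult_right_mono) simp
  then show ?thesis using m by linarith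
qed

section \<open>The proximal map\<close>

text \<open>Exact second-order Taylor expansion of a quadratic; symmetry of \<open>Q\<close> merges
  the two cross terms into the gradient term.\<close>

lemma prox_objective_expand:
  fixes Q :: "real^'n^'n"
  assumes "transpose Q = Q"
  shows "prox_objective Q q \<rho> u y = prox_objective Q q \<rho> u x
      + (Q *v x + q + \<rho> *\<^sub>R (x - u)) \<bullet> (y - x)
      + 1/2 * ((y - x) \<bullet> (Q *v (y - x)) + \<rho> * ((y - x) \<bullet> (y - x)))"
proof -
  define d where "d = y - x"
  have y: "y = x + d" by (simp add: d_def)
  show ?thesis
    unfolding y prox_objective_def
    by (simp add: matrix_vector_right_distrib inner_add_left inner_add_right inner_diff_left inner_diff_right
        power2_norm_eq_inner symmetric_inner[OF assms, of x d] inner_commute field_simps)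
qed

lemma prox_objective_lower_bound:
  fixes Q :: "real^'n^'n"
  assumes "transpose Q = Q"
  shows "prox_objective Q q \<rho> u x + (Q *v x + q + \<rho> *\<^sub>R (x - u)) \<bullet> (y - x)
      + (smallest_eigenvalue Q + \<rho>) / 2 * (norm (y - x))\<^sup>2 \<le> prox_objective Q q \<rho> u y"
  using smallest_eigenvalue_le_Rayleigh[OF assms, of "y - x"]
  unfolding prox_objective_expand[OF assms, of q \<rho> u y x]
  by (simp add: dot_square_norm distrib_right add_divide_distrib)

text \<open>Strong convexity gives coercivity: outside a large ball around some \<open>z\<close> in
  \<open>C\<close> the objective is at least its value at \<open>z\<close>, so minimizing over a
  compact piece of \<open>C\<close> suffices.\<close>

lemma prox_minimizer_exists:
  fixes Q :: "real^'n^'n"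
  assumes sym: "transpose Q = Q" and C: "C \<noteq> {}" "closed C"
    and pos: "\<rho> > - smallest_eigenvalue Q"
  obtains x where "is_arg_min (prox_objective Q q \<rho> u) (\<lambda>x. x \<in> C) x"
proof -
  let ?f = "prox_objective Q q \<rho> u"
  define c where "c = smallest_eigenvalue Q + \<rho>"
  have c: "c > 0" using pos by (simp add: c_def)
  obtain z where z: "z \<in> C" using C by auto
  define g where "g = Q *v z + q + \<rho> *\<^sub>R (z - u)"
  \<comment> \<open>Beyond this distance \<open>c / 2 * (norm (y - z))\<^sup>2\<close> outweighs the
    linear term, which is at least \<open>- norm g * norm (y - z)\<close>.\<close>
  define r where "r = 2 * norm g / c"
  have r: "r \<ge> 0" using c by (simp add: r_def)
  have out: "?f z \<le> ?f y" if "y \<notin> cball z r" for y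
  proof -
    have "2 * norm g \<le> c * norm (y - z)"
      using that c by (simp add: r_def dist_norm norm_minus_commute field_simps)
    then have "2 * norm g * norm (y - z) \<le> c * norm (y - z) * norm (y - z)"
      by (rule mult_right_mono) simp
    moreover have "- (g \<bullet> (y - z)) \<le> norm g * norm (y - z)"
      using Cauchy_Schwarz_ineq2[of g "y - z"] by linarith
    moreover have "?f z + g \<bullet> (y - z) + c / 2 * (norm (y - z))\<^sup>2 \<le> ?f y"
      unfolding g_def c_def by (rule prox_objective_lower_bound[OF sym])
    ultimately show ?thesis by (simp add: power2_eq_square field_simps)
  qed
  have "compact (C \<inter> cball z r)" using C by (intro closed_Int_compact) auto
  moreover have "C \<inter> cball z r \<noteq> {}" using z r by auto
  moreover have "continuous_on (C \<inter> cball z r) ?f"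
    unfolding prox_objective_def[abs_def]
    by (intro continuous_intros linear_continuous_on matrix_vector_mul_bounded_linear)
  ultimately obtain x where x: "x \<in> C" and xmin: "\<And>y. y \<in> C \<inter> cball z r \<Longrightarrow> ?f x \<le> ?f y"
    using continuous_attains_inf[of "C \<inter> cball z r" ?f] by blast
  have "?f x \<le> ?f y" if "y \<in> C" for y
    using xmin[of y] xmin[of z] out[of y] z r that by (cases "y \<in> cball z r") force+
  then show ?thesis using x that by (auto simp: is_arg_min_linorder)
qed

text \<open>Were the directional derivative towards \<open>y\<close> negative, a short step along
  the segment to \<open>y\<close>, which stays in \<open>C\<close> by convexity, would lower the
  objective.\<close>

lemma prox_variational_inequality:
  fixes Q :: "real^'n^'n"
  assumes sym: "transpose Q = Q" and "convex C"
    and x: "is_arg_min (prox_objective Q q \<rho> u) (\<lambda>x. x \<in> C) x" and y: "y \<in> C"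
  shows "(Q *v x + q + \<rho> *\<^sub>R (x - u)) \<bullet> (y - x) \<ge> 0"
proof (rule ccontr)
  define g where "g = (Q *v x + q + \<rho> *\<^sub>R (x - u)) \<bullet> (y - x)"
  define k where "k = (y - x) \<bullet> (Q *v (y - x)) + \<rho> * ((y - x) \<bullet> (y - x))"
  assume "\<not> ?thesis"
  then have g: "g < 0" by (simp add: g_def)
  \<comment> \<open>The bound 1 keeps the point on the segment; the other bound lets the quadratic
    term undo at most half of the linear decrease \<open>t * g\<close>.\<close>
  define t where "t = min 1 (- g / (\<bar>k\<bar> + 1))"
  have t: "0 < t" "t \<le> 1" "t * \<bar>k\<bar> \<le> - g"
  proof -
    show "0 < t" using g by (simp add: t_def divide_neg_pos)
    show "t \<le> 1" by (simp add: t_def)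
    have "t \<le> - g / (\<bar>k\<bar> + 1)" by (simp add: t_def)
    then have "t * (\<bar>k\<bar> + 1) \<le> - g" by (subst (asm) pos_le_divide_eq) auto
    then show "t * \<bar>k\<bar> \<le> - g" using \<open>0 < t\<close> by (simp add: distrib_left)
  qed
  have "x + t *\<^sub>R (y - x) \<in> C"
    using convexD_alt[OF \<open>convex C\<close> _ y, of x t] x t by (simp add: is_arg_min_linorder algebra_simps)
  then have "prox_objective Q q \<rho> u x \<le> prox_objective Q q \<rho> u (x + t *\<^sub>R (y - x))"
    using x by (simp add: is_arg_min_linorder)
  then have "0 \<le> t * g + 1/2 * (t\<^sup>2 * k)"
    unfolding prox_objective_expand[OF sym, of q \<rho> u "x + t *\<^sub>R (y - x)" x]
    by (simp add: matrix_vector_mult_scaleR g_def k_def power2_eq_square algebra_simps del: scaleR_right_diff_distrib)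
  then have "0 \<le> t * (g + t * k / 2)" by (simp add: power2_eq_square algebra_simps)
  moreover have "t * k \<le> t * \<bar>k\<bar>" using t by (intro mult_left_mono) auto
  ultimately show False using t g by (simp add: zero_le_mult_iff)
qed

text \<open>Each minimizer is the test point in the other's variational inequality; in the sum
  \<open>q\<close> cancels. The case \<open>u = v\<close> also yields uniqueness of the
  minimizer.\<close>

lemma prox_minimizer_dist:
  fixes Q :: "real^'n^'n"
  assumes sym: "transpose Q = Q" and C: "convex C"
    and \<rho>: "\<rho> > 0" "\<rho> > - smallest_eigenvalue Q"
    and x: "is_arg_min (prox_objective Q q \<rho> u) (\<lambda>x. x \<in> C) x"
    and y: "is_arg_min (prox_objective Q q \<rho> v) (\<lambda>x. x \<in> C) y"
  shows "norm (x - y) \<le> \<rho> / (smallest_eigenvalue Q + \<rho>) * norm (u - v)"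
proof -
  define c where "c = smallest_eigenvalue Q + \<rho>"
  have c: "c > 0" using \<rho> by (simp add: c_def)
  have "x \<in> C" "y \<in> C" using x y by (auto simp: is_arg_min_linorder)
  define d where "d = x - y"
  have xd: "x = y + d" by (simp add: d_def)
  have "0 \<le> (Q *v x + q + \<rho> *\<^sub>R (x - u)) \<bullet> (y - x) + (Q *v y + q + \<rho> *\<^sub>R (y - v)) \<bullet> (x - y)"
    using prox_variational_inequality[OF sym C x \<open>y \<in> C\<close>] prox_variational_inequality[OF sym C y \<open>x \<in> C\<close>]
    by (rule add_nonneg_nonneg)
  also have "\<dots> = \<rho> * ((u - v) \<bullet> d) - d \<bullet> (Q *v d) - \<rho> * (d \<bullet> d)"
    by (simp add: xd matrix_vector_right_distrib inner_add_left inner_add_right inner_diff_left inner_diff_right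
        inner_commute algebra_simps)
  finally have "c * (norm d)\<^sup>2 \<le> \<rho> * ((u - v) \<bullet> d)"
    using smallest_eigenvalue_le_Rayleigh[OF sym, of d] by (simp add: c_def dot_square_norm algebra_simps)
  also have "\<dots> \<le> \<rho> * (norm (u - v) * norm d)"
    using \<rho> norm_cauchy_schwarz by (intro mult_left_mono) auto
  finally have "norm d * (c * norm d) \<le> norm d * (\<rho> * norm (u - v))"
    by (simp add: power2_eq_square algebra_simps)
  then have "c * norm d \<le> \<rho> * norm (u - v)"
    using \<rho> by (cases "d = 0") auto
  then show ?thesis using c by (simp add: c_def d_def field_simps)
qed

lemma is_arg_min_F_C:
  fixes Q :: "real^'n^'n"
  assumes "transpose Q = Q" and "C \<noteq> {}" "closed C" "convex C"
    and "\<rho> > 0" "\<rho> > - smallest_eigenvalue Q"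
  shows "is_arg_min (prox_objective Q q \<rho> u) (\<lambda>x. x \<in> C) (F_C Q q \<rho> C u)"
proof -
  obtain x where x: "is_arg_min (prox_objective Q q \<rho> u) (\<lambda>x. x \<in> C) x"
    using prox_minimizer_exists assms by blast
  moreover have "y = x" if "is_arg_min (prox_objective Q q \<rho> u) (\<lambda>x. x \<in> C) y" for y
    using prox_minimizer_dist[OF assms(1,4,5,6) that x] by simp
  ultimately show ?thesis unfolding F_C_def by (rule theI)
qed

lemma F_C_lipschitz:
  fixes Q :: "real^'n^'n"
  assumes "transpose Q = Q" and "C \<noteq> {}" "closed C" "convex C"
    and "\<rho> > 0" "\<rho> > - smallest_eigenvalue Q"
  shows "(\<rho> / (smallest_eigenvalue Q + \<rho>))-lipschitz_on UNIV (F_C Q q \<rho> C)"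
proof (rule lipschitz_onI)
  show "dist (F_C Q q \<rho> C u) (F_C Q q \<rho> C v) \<le> \<rho> / (smallest_eigenvalue Q + \<rho>) * dist u v" for u v
    unfolding dist_norm
    by (rule prox_minimizer_dist[OF assms(1,4,5,6)]; rule is_arg_min_F_C[OF assms])
qed (use assms in simp)

section \<open>Global solutions of Lipschitz differential equations\<close>

text \<open>An antiderivative on the whole line replaces the integral from 0 to \<open>t\<close>, so
  that both signs of \<open>t\<close> are covered by one formula.\<close>

lemma antiderivative_UNIV:
  fixes g :: "real \<Rightarrow> 'a::euclidean_space"
  assumes "continuous_on UNIV g"
  obtains G where "G 0 = 0" "\<And>t. (G has_vector_derivative g t) (at t)"
proof -
  obtain F where F: "\<And>t. (F has_vector_derivative g t) (at t)"
    using einterval_antiderivative[of "-\<infinity>" \<infinity> g] assms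
    by (auto simp: continuous_on_eq_continuous_at)
  have "((\<lambda>t. F t - F 0) has_vector_derivative g t) (at t)" for t
    using F[of t] by (simp add: has_vector_derivative_diff_const)
  then show ?thesis using that[of "\<lambda>t. F t - F 0"] by simp
qed

text \<open>Time reversal, by which estimates for negative times follow from those for positive
  times.\<close>

lemma has_vector_derivative_mirror:
  assumes "(x has_vector_derivative d) (at (- t))"
  shows "((\<lambda>s. x (- s)) has_vector_derivative - d) (at t)"
proof -
  have "(uminus has_vector_derivative - 1) (at t)" by (auto intro!: derivative_eq_intros)
  then show ?thesis using vector_diff_chain_at[of uminus "-1" t x d] assms by (simp add: o_def)
qed

text \<open>Integrating the bound on \<open>g\<close> gains the factor \<open>1 / K\<close>, the
  source of the contraction constant below.\<close>

lemma exp_growth_bound: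
  fixes G :: "real \<Rightarrow> 'a::euclidean_space"
  assumes K: "K > 0" and B: "B \<ge> 0" and G0: "G 0 = 0"
    and G: "\<And>t. (G has_vector_derivative g t) (at t)"
    and g: "\<And>t. norm (g t) \<le> B * exp (K * \<bar>t\<bar>)"
  shows "norm (G t) \<le> B / K * exp (K * \<bar>t\<bar>)"
proof -
  have forward: "norm (H t) \<le> B / K * exp (K * t)"
    if t: "t \<ge> 0" and H0: "H 0 = 0" and H: "\<And>t. (H has_vector_derivative h t) (at t)"
      and h: "\<And>t. norm (h t) \<le> B * exp (K * \<bar>t\<bar>)" for t and H h :: "real \<Rightarrow> 'a"
  proof (cases "t = 0")
    case False
    have "norm (H t - H 0) \<le> B / K * exp (K * t) - B / K * exp (K * 0)"
    proof (rule differentiable_bound_general[where f' = h and \<phi>' = "\<lambda>s. B * exp (K * s)"])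
      show "continuous_on {0..t} H"
        using H by (intro continuous_at_imp_continuous_on) (auto intro: has_vector_derivative_continuous)
      show "((\<lambda>s. B / K * exp (K * s)) has_vector_derivative B * exp (K * s)) (at s)" for s
        using K by (auto intro!: derivative_eq_intros simp flip: has_real_derivative_iff_has_vector_derivative)
      show "norm (h s) \<le> B * exp (K * s)" if "0 < s" for s
        using h[of s] that by simp
      show "continuous_on {0..t} (\<lambda>s. B / K * exp (K * s))"
        by (intro continuous_intros)
    qed (use False t H in auto)
    moreover have "B / K \<ge> 0" using K B by simp
    ultimately show ?thesis using H0 by simp
  qed (use K B H0 in simp)
  show ?thesis
  proof (cases "t \<ge> 0")
    case True
    then show ?thesis using forward[OF True G0 G g] by simp
  next
    case False
    have "norm (G (- (- t))) \<le> B / K * exp (K * (- t))"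
      by (rule forward[where h = "\<lambda>s. - g (- s)"])
        (use False G0 g[of "- _"] in \<open>auto intro: has_vector_derivative_mirror G\<close>)
    then show ?thesis using False by simp
  qed
qed

text \<open>The Picard operator is conjugated by the weight \<open>exp (K * \<bar>t\<bar>)\<close> with \<open>K > L\<close>: it then acts on bounded
  continuous functions on the whole line and contracts the supremum norm by \<open>L / K\<close>, so that no
  local solutions have to be continued.\<close>

lemma lipschitz_ode_solution_exists:
  fixes f :: "'a::euclidean_space \<Rightarrow> 'a"
  assumes lip: "L-lipschitz_on UNIV f"
  obtains x where "x 0 = x0" "\<And>t. (x has_vector_derivative f (x t)) (at t)"
proof -
  have L: "L \<ge> 0" using lip by (rule lipschitz_on_nonneg)
  \<comment> \<open>The summand 1 gives \<open>L / K < 1\<close>, and keeps \<open>K\<close>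
    positive when \<open>L = 0\<close>.\<close>
  define K where "K = L + 1"
  have K: "K > 0" "L < K" using L by (auto simp: K_def)
  define e where "e t = exp (K * \<bar>t\<bar>)" for t :: real
  have e: "e t > 0" "e t \<ge> 1" "e 0 = 1" for t using K by (auto simp: e_def)
  have e_cont: "continuous_on S e" for S
    unfolding e_def by (intro continuous_intros)
  \<comment> \<open>The bounded function \<open>y\<close> encodes the trajectory
    \<open>e s *\<^sub>R y s\<close>, which may itself grow exponentially; \<open>g y\<close> is the
    vector field along it.\<close>
  define g where "g y s = f (e s *\<^sub>R apply_bcontfun y s)" for y :: "real \<Rightarrow>\<^sub>C 'a" and s
  have g_cont: "continuous_on UNIV (g y)" for y
    unfolding g_def
    by (rule continuous_on_compose2[OF lipschitz_on_continuous_on[OF lip]])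
      (auto intro!: continuous_intros e_cont)
  have "\<exists>G. G 0 = 0 \<and> (\<forall>t. (G has_vector_derivative g y t) (at t))" for y
    by (rule antiderivative_UNIV[OF g_cont[of y]]) (rule exI, rule conjI, assumption, rule allI)
  then obtain I where I: "\<And>y. I y 0 = 0 \<and> (\<forall>t. (I y has_vector_derivative g y t) (at t))"
    by metis
  have I_cont: "continuous_on UNIV (I y)" for y
    using I by (intro continuous_at_imp_continuous_on) (auto intro: has_vector_derivative_continuous)
  have g_bound: "norm (g y t) \<le> (norm (f 0) + L * norm y) * e t" for y t
  proof -
    have "norm (g y t) \<le> norm (f 0) + norm (f (e t *\<^sub>R y t) - f 0)"
      unfolding g_def by (metis add.commute diff_add_cancel norm_triangle_ineq)
    also have "\<dots> \<le> norm (f 0) + L * norm (e t *\<^sub>R y t)"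
      using lipschitz_onD[OF lip, of "e t *\<^sub>R y t" 0] by (simp add: dist_norm)
    also have "\<dots> = norm (f 0) * 1 + L * norm (y t) * e t"
      using e(1)[of t] by simp
    also have "\<dots> \<le> norm (f 0) * e t + L * norm y * e t"
      using e L by (intro add_mono mult_left_mono mult_right_mono norm_bounded) (auto simp: less_imp_le)
    finally show ?thesis by (simp add: distrib_right)
  qed
  define T where "T y = Bcontfun (\<lambda>t. (1 / e t) *\<^sub>R (x0 + I y t))" for y
  \<comment> \<open>\<open>Bcontfun\<close> can be unfolded only on bounded continuous functions.
    Boundedness holds because \<open>I y\<close> grows at most like the weight
    \<open>e\<close>.\<close>
  have T: "T y t = (1 / e t) *\<^sub>R (x0 + I y t)" for y t
  proof -
    have "(\<lambda>t. (1 / e t) *\<^sub>R (x0 + I y t)) \<in> bcontfun"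
    proof (rule bcontfun_normI)
      show "continuous_on UNIV (\<lambda>t. (1 / e t) *\<^sub>R (x0 + I y t))"
        using e by (intro continuous_intros I_cont e_cont) (metis less_irrefl)
      fix t
      let ?B = "(norm (f 0) + L * norm y) / K"
      have "norm (I y t) \<le> ?B * e t"
        unfolding e_def by (rule exp_growth_bound[OF K(1), where g = "g y"])
          (use I g_bound L in \<open>auto simp: e_def\<close>)
      moreover have "norm x0 \<le> norm x0 * e t" using e(2)[of t] by (simp add: mult_le_cancel_left1)
      ultimately have "norm (x0 + I y t) \<le> (norm x0 + ?B) * e t"
        unfolding distrib_right by (metis norm_triangle_mono)
      then show "norm ((1 / e t) *\<^sub>R (x0 + I y t)) \<le> norm x0 + ?B"
        using e(1)[of t] by (simp add: divide_le_eq)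
    qed
    then show ?thesis unfolding T_def by (simp add: Bcontfun_inverse)
  qed
  have "dist (T y) (T z) \<le> L / K * dist y z" for y z
  proof (rule dist_bound)
    fix t
    have "norm (I y t - I z t) \<le> L * dist y z / K * e t"
      unfolding e_def
    \<comment> \<open>Applied with \<open>B = L * dist y z\<close>: integration contributes
      \<open>1 / K\<close>, and division by the weight then leaves the factor
      \<open>L / K\<close>.\<close>
    proof (rule exp_growth_bound[OF K(1), where g = "\<lambda>t. g y t - g z t"])
      show "norm (g y s - g z s) \<le> L * dist y z * exp (K * \<bar>s\<bar>)" for s
      proof -
        have "norm (g y s - g z s) \<le> L * norm (e s *\<^sub>R y s - e s *\<^sub>R z s)"
          unfolding g_def using lipschitz_onD[OF lip, of "e s *\<^sub>R y s" "e s *\<^sub>R z s"] by (simp add: dist_norm)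
        also have "\<dots> = L * (dist (y s) (z s) * e s)"
          using e(1)[of s] by (simp add: dist_norm flip: scaleR_diff_right)
        also have "\<dots> \<le> L * (dist y z * e s)"
          using L e(1)[of s] by (intro mult_left_mono mult_right_mono dist_bounded) auto
        finally show ?thesis by (simp add: e_def)
      qed
    qed (use I L in \<open>auto intro: has_vector_derivative_diff\<close>)
    moreover have "dist (T y t) (T z t) = norm (I y t - I z t) / e t"
      using e(1)[of t] by (simp add: T dist_norm flip: scaleR_diff_right)
    ultimately show "dist (T y t) (T z t) \<le> L / K * dist y z"
      using e(1)[of t] by (simp add: divide_le_eq)
  qed
  then have "\<exists>!y. T y = y"
    using K L by (intro banach_fix_type[of "L / K"]) auto
  then obtain y where y: "T y = y" by auto
  \<comment> \<open>Removing the weight from the fixed point turns \<open>g y t\<close> into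
    \<open>f (x t)\<close>.\<close>
  define x where "x t = x0 + I y t" for t
  have xy: "e t *\<^sub>R y t = x t" for t
    using T[of y t] e(1)[of t] by (simp add: y x_def)
  show ?thesis
  proof
    show "x 0 = x0" using I by (simp add: x_def)
    have "((\<lambda>t. x0 + I y t) has_vector_derivative 0 + g y t) (at t)" for t
      using I by (intro has_vector_derivative_add has_vector_derivative_const) auto
    then show "(x has_vector_derivative f (x t)) (at t)" for t
      by (simp add: g_def xy flip: x_def)
  qed
qed

text \<open>For \<open>t \<ge> 0\<close> the squared norm times \<open>exp (- 2 * L * t)\<close> is
  nonincreasing and starts at 0. The square is differentiable even where \<open>d\<close> vanishes,
  unlike the norm.\<close>

lemma gronwall_zero:
  fixes d :: "real \<Rightarrow> 'a::real_inner"
  assumes d0: "d 0 = 0" and d: "\<And>t. (d has_vector_derivative d' t) (at t)"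
    and bound: "\<And>t. norm (d' t) \<le> L * norm (d t)"
  shows "d t = 0"
proof -
  have forward: "h t = 0"
    if t: "t \<ge> 0" and h0: "h 0 = 0" and h: "\<And>t. (h has_vector_derivative h' t) (at t)"
      and h': "\<And>t. norm (h' t) \<le> L * norm (h t)" for t and h h' :: "real \<Rightarrow> 'a"
  proof -
    have "(h t \<bullet> h t) * exp (- 2 * L * t) \<le> (h 0 \<bullet> h 0) * exp (- 2 * L * 0)"
    proof (rule DERIV_nonpos_imp_nonincreasing[OF t])
      fix s
      have "((\<lambda>s. h s \<bullet> h s) has_vector_derivative h s \<bullet> h' s + h' s \<bullet> h s) (at s)"
        by (rule bounded_bilinear.has_vector_derivative[OF bounded_bilinear_inner h h])
      then have "((\<lambda>s. (h s \<bullet> h s) * exp (- 2 * L * s)) has_real_derivative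
          2 * (h s \<bullet> h' s - L * (h s \<bullet> h s)) * exp (- 2 * L * s)) (at s)"
        unfolding has_real_derivative_iff_has_vector_derivative[symmetric]
        by (auto intro!: derivative_eq_intros simp: inner_commute algebra_simps)
      moreover have "h s \<bullet> h' s \<le> L * (h s \<bullet> h s)"
      proof -
        have "h s \<bullet> h' s \<le> norm (h s) * norm (h' s)" by (rule norm_cauchy_schwarz)
        also have "\<dots> \<le> norm (h s) * (L * norm (h s))" using h' by (intro mult_left_mono) auto
        finally show ?thesis by (simp add: dot_square_norm power2_eq_square algebra_simps)
      qed
      ultimately show "\<exists>y. ((\<lambda>s. (h s \<bullet> h s) * exp (- 2 * L * s)) has_real_derivative y) (at s) \<and> y \<le> 0"
        by (intro exI conjI) (auto simp: mult_le_0_iff)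
    qed
    then have "h t \<bullet> h t \<le> 0" using h0 by (simp add: mult_le_0_iff)
    then show ?thesis by (metis inner_eq_zero_iff inner_ge_zero order_antisym)
  qed
  show ?thesis
  proof (cases "t \<ge> 0")
    case True
    then show ?thesis using forward[OF True d0 d bound] by simp
  next
    case False
    have "d (- (- t)) = 0"
      by (rule forward[where h' = "\<lambda>s. - d' (- s)"])
        (use False d0 bound in \<open>auto intro: has_vector_derivative_mirror d\<close>)
    then show ?thesis by simp
  qed
qed

lemma lipschitz_ode_solution_unique:
  fixes f :: "'a::real_inner \<Rightarrow> 'a"
  assumes lip: "L-lipschitz_on UNIV f"
    and x: "\<And>t. (x has_vector_derivative f (x t)) (at t)"
    and y: "\<And>t. (y has_vector_derivative f (y t)) (at t)"
    and "x 0 = y 0"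
  shows "x = y"
proof
  fix t
  have "x t - y t = 0"
    by (rule gronwall_zero[where d' = "\<lambda>t. f (x t) - f (y t)" and L = L])
      (use assms lipschitz_onD[OF lip] in \<open>auto simp: dist_norm intro: has_vector_derivative_diff\<close>)
  then show "x t = y t" by simp
qed

lemma lipschitz_ode_unique_C1_solution:
  fixes f :: "'a::euclidean_space \<Rightarrow> 'a"
  assumes lip: "L-lipschitz_on UNIV f"
  shows "\<exists>!x. x C1_differentiable_on UNIV \<and> x 0 = x0 \<and> (\<forall>t. (x has_vector_derivative f (x t)) (at t))"
proof -
  obtain x where x: "x 0 = x0" "\<And>t. (x has_vector_derivative f (x t)) (at t)"
    using lipschitz_ode_solution_exists[OF lip] by blast
  have "continuous_on UNIV x"
    using x(2) by (intro continuous_at_imp_continuous_on) (auto intro: has_vector_derivative_continuous)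
  then have "continuous_on UNIV (\<lambda>t. f (x t))"
    by (intro continuous_on_compose2[OF lipschitz_on_continuous_on[OF lip]]) auto
  then have "x C1_differentiable_on UNIV"
    unfolding C1_differentiable_on_def using x(2) by (intro exI[of _ "\<lambda>t. f (x t)"]) simp
  \<comment> \<open>Uniqueness already holds among all differentiable solutions, hence among the C1
    ones.\<close>
  moreover have "y = x" if "y 0 = x0" "\<forall>t. (y has_vector_derivative f (y t)) (at t)" for y
    using that x by (intro lipschitz_ode_solution_unique[OF lip]) auto
  ultimately show ?thesis using x by blast
qed

theorem theorem2p2:
  fixes Q :: "real^'n^'n" and q x0 :: "real^'n" and C :: "(real^'n) set"
    and \<rho> \<eta> :: real
  assumes "transpose Q = Q"
    and "C \<noteq> {}" and "closed C" and "convex C"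
    and "\<rho> > 0" and "\<rho> > - smallest_eigenvalue Q"
    and "\<eta> > 0"
  shows "\<exists>!x :: real \<Rightarrow> real^'n.
           x C1_differentiable_on UNIV \<and> x 0 = x0 \<and>
           (\<forall>t. (x has_vector_derivative (1/\<eta>) *\<^sub>R (F_C Q q \<rho> C (x t) - x t)) (at t))"
proof (rule lipschitz_ode_unique_C1_solution)
  \<comment> \<open>The constant of the proximal map plus 1 for the identity, scaled by the
    prefactor.\<close>
  show "(\<bar>1/\<eta>\<bar> * (\<rho> / (smallest_eigenvalue Q + \<rho>) + 1))-lipschitz_on UNIV
      (\<lambda>v. (1/\<eta>) *\<^sub>R (F_C Q q \<rho> C v - v))"
    by (intro lipschitz_on_cmult lipschitz_on_diff F_C_lipschitz[OF assms(1-6)] lipschitz_on_id)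
qed

end
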